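(* Let $\mathcal{H}$ be a nonzero real Hilbert space, and let $K_1$ and $K_2$ be nonempty closed convex cones in $\mathcal{H}$. Assume that $K_1$ is not a linear subspace and that $K_1\cap K_2=\{0\}$. Assume that at least one of the following holds: (i) There exists $u\in\mathcal{H}$ such that $K_2=\{u\}^{\perp}$. (ii) There exists $u\in\mathcal{H}$ such that $H:=\{u\}^{\perp}$ satisfies $K_2\subseteq H$ and $H\cap K_1=\{0\}$. (iii) There is a finite-dimensional linear subspace $\mathcal{K}$ of $\mathcal{H}$ such that $K_1\subseteq\mathcal{K}$ or $K_2\subseteq\mathcal{K}$. Then $K_1^{\ominus}\cap K_2^{\oplus}\neq\{0\}$ and $K_1^{\oplus}\cap K_2^{\ominus}\neq\{0\}$.
   Context: A set $K\subseteq\mathcal{H}$ is a cone if $K=\mathbb{R}_{++}K$, where $\mathbb{R}_{++}=\{\lambda\in\mathbb{R}:\lambda>0\}$. For a nonempty set $A\subseteq\mathcal{H}$: the polar cone is $A^{\ominus}=\{u\in\mathcal{H}: \langle x,u\rangle\le 0\ \text{for all } x\in A\}$, the dual cone is $A^{\oplus}=-A^{\ominus}$, and $A^{\perp}=\{u\in\mathcal{H}:\langle x,u\rangle=0\ \text{for all } x\in A\}$. *)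

theory Defs
  imports "HOL-Analysis.Analysis"
begin

text \<open>
  A real Hilbert space is a type of sort \<open>{real_inner, complete_space}\<close>.
\<close>

text \<open>
  This is \<open>K = \<real>\<^sub>+\<^sub>+K\<close>, with strictly positive scalars. The library predicate
  \<open>cone\<close> also allows the scalar 0 and so forces \<open>0 \<in> K\<close> for nonempty \<open>K\<close>; the two
  notions differ for sets that are not closed.
\<close>

definition pos_cone :: "'a::real_vector set \<Rightarrow> bool" where
  "pos_cone K \<longleftrightarrow> K = {c *\<^sub>R x | c x. c > 0 \<and> x \<in> K}"

definition polar_cone :: "'a::real_inner set \<Rightarrow> 'a set" where
  "polar_cone A = {u. \<forall>x\<in>A. inner x u \<le> 0}"

definition dual_cone :: "'a::real_inner set \<Rightarrow> 'a set" where
  "dual_cone A = uminus ` polar_cone A"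

text \<open>
  The library's \<open>dim\<close> is 0 on infinite-dimensional subspaces, so finite dimensionality
  cannot be expressed through it and is stated by a finite spanning set.
\<close>

definition fin_dim_subspace :: "'a::real_vector set \<Rightarrow> bool" where
  "fin_dim_subspace V \<longleftrightarrow> subspace V \<and> (\<exists>B. finite B \<and> span B = V)"

end

theory Submission
  imports Defs
begin

text \<open>
  Alternatives (i) and (ii) give a hyperplane that meets \<open>K1\<close> only in 0, so \<open>K1\<close> lies on one side
  of it, and its normal vector separates. Under (iii), local compactness of one of the cones makes
  \<open>K1 - K2\<close> closed. If it were the whole space, every \<open>x \<in> K1\<close> would satisfy \<open>-x = y - z\<close>
  with \<open>y \<in> K1\<close> and \<open>z \<in> K2\<close>; then \<open>z = x + y \<in> K1 \<inter> K2 = {0}\<close>, so \<open>-x = y \<in> K1\<close> and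
  \<open>K1\<close> would be a subspace. Separating a missing point from \<open>K1 - K2\<close> by projection yields the required
  vector. The two conclusions are exchanged by negation.
\<close>

section \<open>Projection onto a closed convex set\<close>

text \<open>The parallelogram law for \<open>z - x\<close> and \<open>z - y\<close>, whose sum is
  twice the vector from the midpoint of \<open>x\<close> and \<open>y\<close> to
  \<open>z\<close>.\<close>

lemma midpoint_parallelogram:
  fixes x y z :: "'a::real_inner"
  shows "(norm (x - y))\<^sup>2 =
    2 * (dist z x)\<^sup>2 + 2 * (dist z y)\<^sup>2 - 4 * (dist z ((1/2) *\<^sub>R x + (1/2) *\<^sub>R y))\<^sup>2"
proof -
  let ?a = "z - x" and ?b = "z - y"
  have "z - ((1/2) *\<^sub>R x + (1/2) *\<^sub>R y) = (1/2) *\<^sub>R (?a + ?b)"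
    by (simp add: algebra_simps flip: scaleR_left_distrib)
  then have "4 * (dist z ((1/2) *\<^sub>R x + (1/2) *\<^sub>R y))\<^sup>2 = (norm (?a + ?b))\<^sup>2"
    by (simp add: dist_norm power_mult_distrib power_divide)
  moreover have "(norm (x - y))\<^sup>2 = (norm (?b - ?a))\<^sup>2"
    by simp
  moreover have "(norm (?b - ?a))\<^sup>2 = 2 * (norm ?a)\<^sup>2 + 2 * (norm ?b)\<^sup>2 - (norm (?a + ?b))\<^sup>2"
    unfolding power2_norm_eq_inner inner_add_left inner_add_right
      inner_diff_left[of ?b ?a] inner_diff_right[of _ ?b ?a] inner_commute[of ?b ?a]
    by simp
  ultimately show ?thesis
    by (simp add: dist_norm)
qed

text \<open>Completeness stands in for compactness: a minimizing sequence is Cauchy. By convexity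
  midpoints of its terms stay in \<open>C\<close>, hence at distance at least \<open>d\<close> from
  \<open>z\<close>, and the parallelogram law then bounds the gap between two terms by their excess
  over the infimum.\<close>

lemma closest_point_attained:
  fixes C :: "'a::{real_inner, complete_space} set"
  assumes "closed C" "convex C" "C \<noteq> {}"
  obtains p where "p \<in> C" "\<And>x. x \<in> C \<Longrightarrow> dist z p \<le> dist z x"
proof -
  define d where "d = infdist z C"
  have d0: "0 \<le> d" and d_le: "\<And>x. x \<in> C \<Longrightarrow> d \<le> dist z x"
    by (auto simp: d_def infdist_nonneg infdist_le)
  \<comment> \<open>The excess is measured on squared distances, so that the terms in
    \<open>d\<close> cancel in the parallelogram law.\<close>
  have "\<exists>x\<in>C. (dist z x)\<^sup>2 < d\<^sup>2 + inverse (real (Suc n))" for n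
  proof -
    let ?e = "sqrt (d\<^sup>2 + inverse (real (Suc n)))"
    have "d < ?e"
      by (rule real_less_rsqrt) simp
    then obtain x where "x \<in> C" "dist z x < ?e"
      using assms(3) cInf_lessD[of "dist z ` C" ?e] by (auto simp: d_def infdist_def)
    moreover from this have "(dist z x)\<^sup>2 < ?e\<^sup>2"
      by (intro power_strict_mono) auto
    ultimately show ?thesis
      by (intro bexI[of _ x]) auto
  qed
  then obtain X where X: "\<And>n. X n \<in> C"
    and Xd: "\<And>n. (dist z (X n))\<^sup>2 < d\<^sup>2 + inverse (real (Suc n))"
    by metis
  have gap: "(dist (X m) (X n))\<^sup>2 < 2 * inverse (real (Suc m)) + 2 * inverse (real (Suc n))" for m n
  proof -
    have "(1/2) *\<^sub>R X m + (1/2) *\<^sub>R X n \<in> C"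
      using assms(2) X by (intro convexD) auto
    then have "d\<^sup>2 \<le> (dist z ((1/2) *\<^sub>R X m + (1/2) *\<^sub>R X n))\<^sup>2"
      using d0 d_le by (intro power_mono) auto
    then show ?thesis
      using Xd[of m] Xd[of n] midpoint_parallelogram[of "X m" "X n" z] by (simp add: dist_norm)
  qed
  have "Cauchy X"
  proof (rule metric_CauchyI)
    fix e :: real
    assume "0 < e"
    \<comment> \<open>The threshold makes the bound in \<open>gap\<close> less than 2 * e^2/4 + 2 *
      e^2/4 = e^2.\<close>
    then obtain N where N: "inverse (real (Suc N)) < e\<^sup>2 / 4"
      using reals_Archimedean[of "e\<^sup>2 / 4"] by auto
    have "dist (X m) (X n) < e" if "N \<le> m" "N \<le> n" for m n
    proof -
      have "inverse (real (Suc m)) \<le> inverse (real (Suc N))"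
        "inverse (real (Suc n)) \<le> inverse (real (Suc N))"
        using that by (auto intro: le_imp_inverse_le)
      then have "(dist (X m) (X n))\<^sup>2 < e\<^sup>2"
        using gap[of m n] N by linarith
      then show ?thesis
        using \<open>0 < e\<close> by (simp add: power_less_imp_less_base)
    qed
    then show "\<exists>M. \<forall>m\<ge>M. \<forall>n\<ge>M. dist (X m) (X n) < e"
      by blast
  qed
  then obtain p where p: "X \<longlonglongrightarrow> p"
    using convergent_eq_Cauchy by blast
  have "p \<in> C"
    using assms(1) X p closed_sequentially by blast
  have "(\<lambda>n. (dist z (X n))\<^sup>2) \<longlonglongrightarrow> (dist z p)\<^sup>2"
    by (intro tendsto_intros p)
  moreover have "(\<lambda>n. d\<^sup>2 + inverse (real (Suc n))) \<longlonglongrightarrow> d\<^sup>2 + 0"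
    by (intro tendsto_add tendsto_const LIMSEQ_inverse_real_of_nat)
  ultimately have "(dist z p)\<^sup>2 \<le> d\<^sup>2"
    using Xd by (intro LIMSEQ_le[of _ _ "\<lambda>n. d\<^sup>2 + inverse (real (Suc n))"]) (auto intro: less_imp_le)
  then have "dist z p \<le> d"
    using d0 by (rule power2_le_imp_le)
  with \<open>p \<in> C\<close> d_le show ?thesis
    by (intro that) (auto intro: order_trans)
qed

section \<open>Closed cones\<close>

lemma pos_coneD:
  assumes "pos_cone K" "x \<in> K" "0 < c"
  shows "c *\<^sub>R x \<in> K"
  using assms unfolding pos_cone_def by blast

lemma pos_cone_add:
  assumes "pos_cone K" "convex K" "x \<in> K" "y \<in> K"
  shows "x + y \<in> K"
proof -
  have "(1/2) *\<^sub>R x + (1/2) *\<^sub>R y \<in> K"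
    using assms by (intro convexD) auto
  then have "2 *\<^sub>R ((1/2) *\<^sub>R x + (1/2) *\<^sub>R y) \<in> K"
    using assms(1) by (intro pos_coneD) auto
  then show ?thesis
    by (simp add: scaleR_add_right)
qed

lemma subspace_of_pos_cone:
  assumes "pos_cone K" "convex K" "0 \<in> K" "\<And>x. x \<in> K \<Longrightarrow> - x \<in> K"
  shows "subspace K"
proof (rule subspaceI)
  fix c x
  assume "x \<in> K"
  then show "c *\<^sub>R x \<in> K"
    using assms(3) pos_coneD[OF assms(1), of x c] pos_coneD[OF assms(1), of "- x" "- c"] assms(4)
    by (cases c "0::real" rule: linorder_cases) auto
qed (use assms pos_cone_add in auto)

text \<open>Take \<open>u = z - p\<close> with \<open>p\<close> the point of \<open>C\<close>
  nearest to \<open>z\<close>. The obtuse angle criterion at \<open>p\<close>, tested against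
  \<open>p + x\<close>, which is again in the cone, says exactly that \<open>inner x u\<close> is
  nonpositive.\<close>

lemma exists_nonzero_polar_vector:
  fixes C :: "'a::{real_inner, complete_space} set"
  assumes "closed C" "convex C" "pos_cone C" "0 \<in> C" "z \<notin> C"
  obtains u where "u \<noteq> 0" "\<And>x. x \<in> C \<Longrightarrow> inner x u \<le> 0"
proof -
  obtain p where p: "p \<in> C" "\<And>x. x \<in> C \<Longrightarrow> dist z p \<le> dist z x"
    using closest_point_attained assms by blast
  have dot: "inner (z - p) (x - p) \<le> 0" if "x \<in> C" for x
    using any_closest_point_dot[of C p x z] assms p that by blast
  have "inner x (z - p) \<le> 0" if "x \<in> C" for x
    using dot[of "p + x"] pos_cone_add[OF assms(3,2) p(1) that] by (simp add: inner_commute)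
  moreover have "z - p \<noteq> 0"
    using p assms(5) by auto
  ultimately show ?thesis
    using that by blast
qed

text \<open>Induction on the orthogonal set: by Pythagoras, the component along \<open>a\<close> and
  the remainder both have norm at most \<open>r\<close>, so the vector lies in the sum of a compact
  segment and the compact set for \<open>B\<close>. Such a sum is usually larger than the ball in
  the span, hence an inclusion.\<close>

lemma bounded_span_subset_compact:
  fixes B :: "'a::real_inner set"
  assumes "finite B" "pairwise orthogonal B"
  shows "\<exists>S. compact S \<and> cball 0 r \<inter> span B \<subseteq> S"
  using assms
proof (induction B rule: finite_induct)
  case empty
  then show ?case
    by (intro exI[of _ "{0}"]) auto
next
  case (insert a B)
  then obtain S where S: "compact S" "cball 0 r \<inter> span B \<subseteq> S"
    by (auto simp: pairwise_insert)
  define T where "T = (\<lambda>k. k *\<^sub>R a) ` {- (r / norm a)..r / norm a}"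
  have "compact T"
    unfolding T_def by (intro compact_continuous_image continuous_intros compact_Icc)
  have "x \<in> {s + t | s t. s \<in> S \<and> t \<in> T}" if x: "x \<in> cball 0 r \<inter> span (insert a B)" for x
  proof -
    have "0 \<le> r" "norm x \<le> r"
      using x by (auto intro: order_trans[OF norm_ge_zero])
    obtain k where k: "x - k *\<^sub>R a \<in> span B"
      using x by (auto simp: span_breakdown_eq)
    have "orthogonal a (x - k *\<^sub>R a)"
      using k insert by (intro orthogonal_to_span[OF k]) (auto simp: pairwise_insert)
    then have pyth: "(norm x)\<^sup>2 = (norm (k *\<^sub>R a))\<^sup>2 + (norm (x - k *\<^sub>R a))\<^sup>2"
      using norm_add_Pythagorean[of "k *\<^sub>R a" "x - k *\<^sub>R a"] by (simp add: orthogonal_clauses)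
    have "norm (x - k *\<^sub>R a) \<le> norm x" "norm (k *\<^sub>R a) \<le> norm x"
      by (rule power2_le_imp_le; simp add: pyth)+
    then have le: "norm (x - k *\<^sub>R a) \<le> r" "\<bar>k\<bar> * norm a \<le> r"
      using \<open>norm x \<le> r\<close> by auto
    have "k *\<^sub>R a \<in> T"
    proof (cases "a = 0")
      \<comment> \<open>Division by zero yields 0, so \<open>T\<close> is just {0} here.\<close>
      case True
      then show ?thesis
        using \<open>0 \<le> r\<close> by (auto simp: T_def)
    next
      case False
      then have "\<bar>k\<bar> \<le> r / norm a"
        using le(2) by (simp add: field_simps)
      then show ?thesis
        by (auto simp: T_def abs_le_iff)
    qed
    moreover have "x - k *\<^sub>R a \<in> S"
      using S(2) k le(1) by auto
    ultimately show ?thesis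
      by (intro CollectI exI[of _ "x - k *\<^sub>R a"] exI[of _ "k *\<^sub>R a"]) simp
  qed
  then show ?case
    using compact_sums[OF S(1) \<open>compact T\<close>] by blast
qed

lemma compact_fin_dim_Int:
  fixes V :: "'a::real_inner set"
  assumes "fin_dim_subspace V" "closed K" "K \<subseteq> V"
  shows "compact (K \<inter> cball 0 r)"
proof -
  obtain B where B: "finite B" "span B = V"
    using assms(1) by (auto simp: fin_dim_subspace_def)
  obtain C where C: "finite C" "span C = V" "pairwise orthogonal C"
    using basis_orthogonal[OF B(1)] B(2) by auto
  obtain S where S: "compact S" "cball 0 r \<inter> V \<subseteq> S"
    using bounded_span_subset_compact[OF C(1,3), of r] C(2) by auto
  have "compact (S \<inter> (K \<inter> cball 0 r))"
    using S(1) assms(2) by (intro compact_Int_closed closed_Int closed_cball)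
  moreover have "S \<inter> (K \<inter> cball 0 r) = K \<inter> cball 0 r"
    using S(2) assms(3) by auto
  ultimately show ?thesis
    by simp
qed

text \<open>The unit vectors of \<open>A\<close> form a compact set disjoint from \<open>B\<close>,
  so their differences with \<open>B\<close> form a closed set missing 0; \<open>d\<close> is the
  radius of a ball around 0 that avoids it. Dividing \<open>x\<close> and \<open>y\<close> by
  \<open>norm x\<close> reduces the general case to this one.\<close>

lemma norm_le_norm_cone_diff:
  fixes A B :: "'a::real_inner set"
  assumes "fin_dim_subspace V" "A \<subseteq> V" "closed A" "pos_cone A"
    and "closed B" "pos_cone B" "A \<inter> B = {0}"
  obtains d where "0 < d" "\<And>x y. x \<in> A \<Longrightarrow> y \<in> B \<Longrightarrow> d * norm x \<le> norm (y - x)"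
proof -
  let ?S = "A \<inter> cball 0 1 \<inter> {x. norm x = 1}"
  have "compact ?S"
    using compact_fin_dim_Int[OF assms(1,3,2), of 1] by (rule compact_Int_closed) (intro closed_Collect_eq continuous_intros)
  then have "closed (\<Union>y\<in>B. \<Union>x\<in>?S. {y - x})" (is "closed ?D")
    using assms(5) closed_compact_differences by blast
  moreover have "0 \<notin> ?D"
  proof
    assume "0 \<in> ?D"
    then obtain x where "x \<in> A \<inter> B" "norm x = 1"
      by auto
    then show False
      unfolding assms(7) by simp
  qed
  ultimately obtain d where d: "0 < d" "ball 0 d \<subseteq> - ?D"
    by (meson ComplI openE open_Compl)
  have "d * norm x \<le> norm (y - x)" if xy: "x \<in> A" "y \<in> B" for x y
  proof (cases "x = 0")
    case False
    let ?c = "inverse (norm x)"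
    have "?c *\<^sub>R x \<in> ?S" "?c *\<^sub>R y \<in> B"
      using False xy pos_coneD[OF assms(4)] pos_coneD[OF assms(6)] by simp_all
    then have "?c *\<^sub>R y - ?c *\<^sub>R x \<in> ?D"
      by blast
    then have "?c *\<^sub>R y - ?c *\<^sub>R x \<notin> ball 0 d"
      using d(2) by blast
    then have "d \<le> norm (y - x) / norm x"
      by (simp add: divide_inverse_commute flip: scaleR_diff_right)
    then show ?thesis
      using False by (simp add: pos_le_divide_eq)
  qed simp
  with d(1) show ?thesis
    using that by blast
qed

text \<open>A convergent sequence of differences is bounded by some \<open>M\<close>, so the
  preceding estimate confines the subtracted points of \<open>A\<close> to the ball of radius
  \<open>M / d\<close>. That part of \<open>A\<close> is compact, and a closed set minus a compact
  set is closed.\<close>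

lemma closed_cone_diff:
  fixes A B :: "'a::real_inner set"
  assumes "fin_dim_subspace V" "A \<subseteq> V" "closed A" "pos_cone A"
    and "closed B" "pos_cone B" "A \<inter> B = {0}"
  shows "closed {y - x | x y. x \<in> A \<and> y \<in> B}"
proof -
  obtain d where d: "0 < d" "\<And>x y. x \<in> A \<Longrightarrow> y \<in> B \<Longrightarrow> d * norm x \<le> norm (y - x)"
    using norm_le_norm_cone_diff[OF assms] by blast
  show ?thesis
    unfolding closed_sequential_limits
  proof clarify
    fix f z
    assume f: "\<forall>n. f n \<in> {y - x | x y. x \<in> A \<and> y \<in> B}" and z: "f \<longlonglongrightarrow> z"
    obtain M where M: "\<And>n. norm (f n) \<le> M"
      using convergent_imp_bounded[OF z] by (auto simp: bounded_iff)
    let ?D = "\<Union>y\<in>B. \<Union>x\<in>A \<inter> cball 0 (M / d). {y - x}"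
    have "closed ?D"
      using assms compact_fin_dim_Int closed_compact_differences by blast
    moreover have "f n \<in> ?D" for n
    proof -
      obtain x y where xy: "x \<in> A" "y \<in> B" "f n = y - x"
        using f by blast
      then have "norm x \<le> M / d"
        using d(1) d(2)[OF xy(1,2)] M[of n] by (simp add: pos_le_divide_eq mult.commute)
      then have "x \<in> A \<inter> cball 0 (M / d)"
        using xy(1) by simp
      with xy(2,3) show ?thesis
        by blast
    qed
    ultimately have "z \<in> ?D"
      using z closed_sequentially by blast
    then show "\<exists>x y. z = y - x \<and> x \<in> A \<and> y \<in> B"
      by auto
  qed
qed

section \<open>Separation\<close>

text \<open>If \<open>u\<close> took both signs on \<open>K\<close>, then \<open>K\<close> would lie
  on a single line and contain both of its rays, and so would be a subspace.\<close>

lemma pos_cone_one_sided: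
  fixes K :: "'a::real_inner set"
  assumes "pos_cone K" "convex K" "0 \<in> K" "\<not> subspace K"
    and zero: "\<And>x. x \<in> K \<Longrightarrow> inner x u = 0 \<Longrightarrow> x = 0"
  shows "(\<forall>x\<in>K. inner x u \<le> 0) \<or> (\<forall>x\<in>K. 0 \<le> inner x u)"
proof (rule ccontr)
  assume "\<not> ?thesis"
  then obtain x y where xy: "x \<in> K" "0 < inner x u" "y \<in> K" "inner y u < 0"
    by (auto simp: not_le)
  \<comment> \<open>Rescaled to inner products 1 and -1 with \<open>u\<close>, the two vectors have
    a sum in \<open>K\<close> that is orthogonal to \<open>u\<close>, hence zero.\<close>
  have opposite: "inverse (inner a u) *\<^sub>R a = inverse (inner b u) *\<^sub>R b"
    if "a \<in> K" "0 < inner a u" "b \<in> K" "inner b u < 0" for a b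
  proof -
    have "inverse (inner a u) *\<^sub>R a + inverse (- inner b u) *\<^sub>R b \<in> K"
      using that assms by (intro pos_cone_add pos_coneD) auto
    then have "inverse (inner a u) *\<^sub>R a + inverse (- inner b u) *\<^sub>R b = 0"
      using that by (intro zero) (auto simp: inner_diff_left)
    then show ?thesis
      by simp
  qed
  have neg: "- a \<in> K" if "a \<in> K" for a
  proof (cases "inner a u" "0::real" rule: linorder_cases)
    case less
    \<comment> \<open>Comparison with the fixed \<open>x\<close> on the other side makes
      \<open>a\<close> a negative multiple of \<open>x\<close>, so \<open>- a\<close> is a positive
      one.\<close>
    then have "a = inner a u *\<^sub>R inverse (inner x u) *\<^sub>R x"
      using opposite[OF xy(1,2) that less] by simp
    then have "- a = (- inner a u * inverse (inner x u)) *\<^sub>R x"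
      by simp
    then show ?thesis
      using less xy pos_coneD[OF assms(1) xy(1), of "- inner a u * inverse (inner x u)"]
      by (simp add: mult_neg_pos)
  next
    case equal
    then have "a = 0"
      using zero that by blast
    then show ?thesis
      using assms(3) by simp
  next
    case greater
    have "a = inner a u *\<^sub>R inverse (inner y u) *\<^sub>R y"
      using greater by (simp flip: opposite[OF that greater xy(3,4)])
    then have "- a = (- inner a u * inverse (inner y u)) *\<^sub>R y"
      by simp
    then show ?thesis
      using greater xy pos_coneD[OF assms(1) xy(3), of "- inner a u * inverse (inner y u)"]
      by (simp add: mult_pos_neg)
  qed
  show False
    using subspace_of_pos_cone[OF assms(1-3) neg] assms(4) by blast
qed

lemma separate_by_hyperplane:
  fixes K1 K2 :: "'a::real_inner set"
  assumes "pos_cone K1" "convex K1" "0 \<in> K1" "\<not> subspace K1"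
    and "K2 \<subseteq> orthogonal_comp {u}" "orthogonal_comp {u} \<inter> K1 = {0}"
  obtains v where "v \<noteq> 0" "\<And>x. x \<in> K1 \<Longrightarrow> inner x v \<le> 0" "\<And>x. x \<in> K2 \<Longrightarrow> 0 \<le> inner x v"
proof -
  have K2: "inner x u = 0" if "x \<in> K2" for x
    using assms(5) that by (auto simp: orthogonal_comp_def orthogonal_def inner_commute)
  have K1: "x = 0" if "x \<in> K1" "inner x u = 0" for x
  proof -
    have "x \<in> orthogonal_comp {u}"
      using that(2) by (simp add: orthogonal_comp_def orthogonal_def inner_commute)
    then show ?thesis
      using assms(6) that(1) by blast
  qed
  \<comment> \<open>For \<open>u = 0\<close> the orthogonal complement is the whole space, which
    would force \<open>K1\<close> to be {0}, a subspace.\<close>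
  have "u \<noteq> 0"
  proof
    assume "u = 0"
    then have "K1 = {0}"
      using K1 assms(3) by auto
    then show False
      using assms(4) by simp
  qed
  from pos_cone_one_sided[OF assms(1-4) K1] show ?thesis
  proof
    assume "\<forall>x\<in>K1. inner x u \<le> 0"
    then show ?thesis
      using that[of u] \<open>u \<noteq> 0\<close> K2 by auto
  next
    assume "\<forall>x\<in>K1. 0 \<le> inner x u"
    then show ?thesis
      using that[of "- u"] \<open>u \<noteq> 0\<close> K2 by auto
  qed
qed

lemma separate_if_fin_dim:
  fixes K1 K2 :: "'a::{real_inner, complete_space} set"
  assumes K1: "closed K1" "convex K1" "pos_cone K1" "\<not> subspace K1"
    and K2: "closed K2" "convex K2" "pos_cone K2"
    and Int: "K1 \<inter> K2 = {0}"
    and V: "fin_dim_subspace V" "K1 \<subseteq> V \<or> K2 \<subseteq> V"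
  obtains v where "v \<noteq> 0" "\<And>x. x \<in> K1 \<Longrightarrow> inner x v \<le> 0" "\<And>x. x \<in> K2 \<Longrightarrow> 0 \<le> inner x v"
proof -
  define D where "D = {x - y | x y. x \<in> K1 \<and> y \<in> K2}"
  have zero: "0 \<in> K1" "0 \<in> K2"
    using Int by auto
  have "closed D"
    using V(2)
  proof
    assume "K1 \<subseteq> V"
    \<comment> \<open>\<open>closed_cone_diff\<close> subtracts the cone lying in \<open>V\<close>
      from the other one, so in this case it gives closedness of the negative of
      \<open>D\<close>.\<close>
    then have "closed (uminus ` {y - x | x y. x \<in> K1 \<and> y \<in> K2})"
      using assms by (intro closed_negations closed_cone_diff)
    moreover have "uminus ` {y - x | x y. x \<in> K1 \<and> y \<in> K2} = D"
      by (force simp: D_def image_iff)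
    ultimately show ?thesis
      by simp
  next
    assume "K2 \<subseteq> V"
    then have "closed {y - x | x y. x \<in> K2 \<and> y \<in> K1}"
      using assms by (intro closed_cone_diff) auto
    moreover have "{y - x | x y. x \<in> K2 \<and> y \<in> K1} = D"
      by (auto simp: D_def)
    ultimately show ?thesis
      by simp
  qed
  have "convex D"
  proof -
    have "(\<Union>x\<in>K1. \<Union>y\<in>K2. {x - y}) = D"
      by (auto simp: D_def)
    then show ?thesis
      using convex_differences[OF K1(2) K2(2)] by simp
  qed
  have "pos_cone D"
    unfolding pos_cone_def
  proof (intro set_eqI iffI)
    fix z
    assume "z \<in> D"
    then show "z \<in> {c *\<^sub>R x | c x. c > 0 \<and> x \<in> D}"
      by (auto intro!: exI[of _ 1] exI[of _ z])
  next
    fix z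
    assume "z \<in> {c *\<^sub>R x | c x. c > 0 \<and> x \<in> D}"
    then obtain c x y where "c > 0" "x \<in> K1" "y \<in> K2" "z = c *\<^sub>R x - c *\<^sub>R y"
      by (auto simp: D_def scaleR_diff_right)
    then show "z \<in> D"
      using pos_coneD K1(3) K2(3) unfolding D_def by blast
  qed
  have "0 \<in> D"
    using zero by (force simp: D_def)
  have "D \<noteq> UNIV"
  proof
    assume "D = UNIV"
    have "- x \<in> K1" if "x \<in> K1" for x
    proof -
      obtain y z where yz: "y \<in> K1" "z \<in> K2" "- x = y - z"
        using \<open>D = UNIV\<close> unfolding D_def by blast
      then have "z = x + y"
        by (simp add: algebra_simps)
      then have "z = 0"
        using pos_cone_add[OF K1(3,2) that yz(1)] yz(2) Int by blast
      then show ?thesis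
        using yz by simp
    qed
    then show False
      using subspace_of_pos_cone K1 zero(1) by blast
  qed
  then obtain w where "w \<notin> D"
    by blast
  then obtain v where v: "v \<noteq> 0" "\<And>x. x \<in> D \<Longrightarrow> inner x v \<le> 0"
    using exists_nonzero_polar_vector[OF \<open>closed D\<close> \<open>convex D\<close> \<open>pos_cone D\<close> \<open>0 \<in> D\<close>] by blast
  \<comment> \<open>Since 0 lies in both cones, \<open>D\<close> contains \<open>K1\<close> and the
    negatives of \<open>K2\<close>.\<close>
  have "inner x v \<le> 0" if "x \<in> K1" for x
    using that zero(2) by (intro v(2)) (force simp: D_def)
  moreover have "0 \<le> inner y v" if "y \<in> K2" for y
  proof -
    have "- y \<in> D"
      using that zero(1) by (force simp: D_def)
    then show ?thesis
      using v(2)[of "- y"] by simp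
  qed
  ultimately show ?thesis
    using that v(1) by blast
qed

theorem theorem4p11:
  fixes K1 K2 :: "'a::{real_inner, complete_space} set"
  assumes "\<exists>x::'a. x \<noteq> 0"
    and "K1 \<noteq> {}" "closed K1" "convex K1" "pos_cone K1"
    and "K2 \<noteq> {}" "closed K2" "convex K2" "pos_cone K2"
    and "\<not> subspace K1"
    and "K1 \<inter> K2 = {0}"
    and "(\<exists>u. K2 = orthogonal_comp {u})
       \<or> (\<exists>u. K2 \<subseteq> orthogonal_comp {u} \<and> orthogonal_comp {u} \<inter> K1 = {0})
       \<or> (\<exists>V. fin_dim_subspace V \<and> (K1 \<subseteq> V \<or> K2 \<subseteq> V))"
  shows "polar_cone K1 \<inter> dual_cone K2 \<noteq> {0} \<and> dual_cone K1 \<inter> polar_cone K2 \<noteq> {0}"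
proof -
  have zero: "0 \<in> K1"
    using assms(11) by auto
  \<comment> \<open>Alternative (i) is an instance of (ii): if \<open>K2\<close> is itself the
    hyperplane, then its intersection with \<open>K1\<close> is {0} by assumption.\<close>
  consider u where "K2 \<subseteq> orthogonal_comp {u}" "orthogonal_comp {u} \<inter> K1 = {0}"
    | V where "fin_dim_subspace V" "K1 \<subseteq> V \<or> K2 \<subseteq> V"
    using assms(11,12) by (metis Int_commute order_refl)
  then obtain v where v: "v \<noteq> 0" "\<And>x. x \<in> K1 \<Longrightarrow> inner x v \<le> 0" "\<And>x. x \<in> K2 \<Longrightarrow> 0 \<le> inner x v"
  proof cases
    case 1
    show ?thesis
      using separate_by_hyperplane[OF assms(5,4) zero assms(10) 1] that by blast
  next
    case 2
    show ?thesis
      using separate_if_fin_dim[OF assms(3-5,10,7-9,11) 2] that by blast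
  qed
  have "v \<in> polar_cone K1" "- v \<in> polar_cone K2"
    using v by (auto simp: polar_cone_def)
  then have "v \<in> polar_cone K1 \<inter> dual_cone K2" "- v \<in> dual_cone K1 \<inter> polar_cone K2"
    unfolding dual_cone_def by (auto intro: image_eqI[of _ _ "- v"])
  moreover have "- v \<noteq> 0"
    using v(1) by simp
  ultimately show ?thesis
    using v(1) by blast
qed

end
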